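(* Let $Y\subset\mathbb A^d_{\mathbb R}$ be a smooth affine scheme over $\mathbb R$ such that $C:=Y(\mathbb R)\subset\mathbb R^d$ is compact, and let $Y_{\mathbb C}\subset\mathbb A^d_{\mathbb C}$ be its base change. Let $H_1,H_2,\ldots$ be a sequence of algebraic hypersurfaces of $\mathbb C^d$ all of degree $D$ such that $H_m\cap Y_{\mathbb C}$ is a proper hypersurface of $Y_{\mathbb C}$ for every $m$. Then there is a subsequence $H_{m_1},H_{m_2},\ldots$ and a proper algebraic hypersurface $H\subset\mathbb C^d$ of degree at most $D$ such that the sequence $H_{m_1}\cap C,H_{m_2}\cap C,\ldots$ converges to $H\cap C$.
   Context: $d(\cdot,\cdot)$ denotes the Euclidean metric on $\mathbb R^d$ (and $C\subset\mathbb R^d\subset\mathbb C^d$). For $\epsilon>0$ and $S\subset C$, $S(\epsilon)=\{z\in C:\exists y\in S,\ d(z,y)<\epsilon\}$. A sequence $S_1,S_2,\ldots$ of subsets of $C$ converges to $S\subset C$ if for every $\epsilon>0$ there is $n_\epsilon$ with $S_m\subset S(\epsilon)$ for all $m\ge n_\epsilon$. *)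

theory Defs
  imports "HOL-Analysis.Analysis" "HOL-Library.Poly_Mapping"
begin

section \<open>Polynomials in finitely many variables\<close>

text \<open>
  The polynomial ring in the variables \<open>x\<^sub>i\<close>, \<open>i\<close> ranging over the finite type \<open>'n\<close>, over \<open>'a\<close>:
  finitely supported functions from exponent vectors to coefficients. The ring operations are those
  of \<^theory>\<open>HOL-Library.Poly_Mapping\<close> (convolution product).
\<close>

type_synonym ('n, 'a) mpoly = "('n \<Rightarrow>\<^sub>0 nat) \<Rightarrow>\<^sub>0 'a"

definition eval_mpoly :: "('n::finite, 'a::comm_semiring_1) mpoly \<Rightarrow> 'a ^ 'n \<Rightarrow> 'a" where
  "eval_mpoly f z =
     (\<Sum>m\<in>Poly_Mapping.keys f. Poly_Mapping.lookup f m * (\<Prod>i\<in>UNIV. (z $ i) ^ Poly_Mapping.lookup m i))"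

definition total_degree :: "('n::finite, 'a::zero) mpoly \<Rightarrow> nat" where
  "total_degree f = Max (insert 0 ((\<lambda>m. \<Sum>i\<in>UNIV. Poly_Mapping.lookup m i) ` Poly_Mapping.keys f))"

text \<open>
  Truncated subtraction of exponents is harmless: a monomial without \<open>x\<^sub>i\<close> contributes the
  coefficient \<open>0\<close>.
\<close>

definition partial_deriv :: "'n \<Rightarrow> ('n::finite, 'a::comm_semiring_1) mpoly \<Rightarrow> ('n, 'a) mpoly" where
  "partial_deriv i f =
     (\<Sum>m\<in>Poly_Mapping.keys f.
        Poly_Mapping.single (m - Poly_Mapping.single i 1)
          (of_nat (Poly_Mapping.lookup m i) * Poly_Mapping.lookup f m))"

definition complexify :: "('n, real) mpoly \<Rightarrow> ('n, complex) mpoly" where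
  "complexify f = Poly_Mapping.map complex_of_real f"

definition zero_locus :: "('n::finite, 'a::comm_semiring_1) mpoly set \<Rightarrow> ('a ^ 'n) set" where
  "zero_locus F = {z. \<forall>f\<in>F. eval_mpoly f z = 0}"


section \<open>Ideals\<close>

text \<open>Ideals are the submodules of the ring regarded as a module over itself.\<close>

abbreviation is_ideal :: "'r::comm_ring_1 set \<Rightarrow> bool" where
  "is_ideal I \<equiv> module.subspace times I"

abbreviation ideal_gen :: "'r::comm_ring_1 set \<Rightarrow> 'r set" where
  "ideal_gen F \<equiv> module.span times F"

definition is_prime_ideal :: "'r::comm_ring_1 set \<Rightarrow> bool" where
  "is_prime_ideal P \<longleftrightarrow> is_ideal P \<and> 1 \<notin> P \<and> (\<forall>a b. a * b \<in> P \<longrightarrow> a \<in> P \<or> b \<in> P)"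


section \<open>Affine schemes over the reals\<close>

text \<open>
  A closed subscheme \<open>Y = Spec (\<real>[x] / I)\<close> of affine space over \<open>\<real>\<close> is represented by its ideal \<open>I\<close>,
  and a (not necessarily closed) point of \<open>Y\<close> is a prime ideal \<open>P\<close> containing \<open>I\<close>. Then
  \<open>Y(\<real>)\<close> is \<open>zero_locus I\<close>.

  \<open>Y\<close> is smooth over \<open>\<real>\<close> at \<open>P\<close> if, in some neighbourhood \<open>h \<noteq> 0\<close> of \<open>P\<close>, the ideal \<open>I\<close> is generated
  by elements \<open>g\<^sub>0, \<dots>, g\<^sub>c\<^sub>-\<^sub>1\<close> whose differentials are linearly independent in
  \<open>\<Omega> \<otimes> \<kappa>(P)\<close>, i.e. the rows of the Jacobian matrix are linearly independent over
  \<open>\<kappa>(P) = Frac (\<real>[x] / P)\<close>. After clearing denominators, it is enough to test independence with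
  coefficients \<open>a\<close> in \<open>\<real>[x] / P\<close>. The number \<open>c\<close>, the local codimension, may depend on \<open>P\<close>.
\<close>

definition smooth_at :: "('n::finite, real) mpoly set \<Rightarrow> ('n, real) mpoly set \<Rightarrow> bool" where
  "smooth_at I P \<longleftrightarrow>
     (\<exists>(c::nat) g h. (\<forall>k<c. g k \<in> I) \<and> h \<notin> P \<and> (\<forall>f\<in>I. h * f \<in> ideal_gen (g ` {..<c})) \<and>
        (\<forall>a. (\<forall>i. (\<Sum>k<c. a k * partial_deriv i (g k)) \<in> P) \<longrightarrow> (\<forall>k<c. a k \<in> P)))"

definition smooth_affine :: "('n::finite, real) mpoly set \<Rightarrow> bool" where
  "smooth_affine I \<longleftrightarrow> is_ideal I \<and> (\<forall>P. is_prime_ideal P \<and> I \<subseteq> P \<longrightarrow> smooth_at I P)"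

definition base_change :: "('n::finite, real) mpoly set \<Rightarrow> ('n, complex) mpoly set" where
  "base_change I = ideal_gen (complexify ` I)"


section \<open>Hypersurfaces\<close>

definition zariski_closed :: "(complex ^ 'n::finite) set \<Rightarrow> bool" where
  "zariski_closed Z \<longleftrightarrow> (\<exists>F. Z = zero_locus F)"

definition zariski_irreducible :: "(complex ^ 'n::finite) set \<Rightarrow> bool" where
  "zariski_irreducible Z \<longleftrightarrow> zariski_closed Z \<and> Z \<noteq> {} \<and>
     (\<forall>A B. zariski_closed A \<and> zariski_closed B \<and> Z = A \<union> B \<longrightarrow> Z = A \<or> Z = B)"

definition irreducible_component :: "(complex ^ 'n::finite) set \<Rightarrow> (complex ^ 'n) set \<Rightarrow> bool" where
  "irreducible_component X Z \<longleftrightarrow> zariski_irreducible Z \<and> Z \<subseteq> X \<and>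
     (\<forall>W. zariski_irreducible W \<and> Z \<subseteq> W \<and> W \<subseteq> X \<longrightarrow> W = Z)"

text \<open>Krull codimension in \<open>X\<close> of an irreducible closed subset \<open>Z\<close> of \<open>X\<close>.\<close>

definition codimension :: "(complex ^ 'n::finite) set \<Rightarrow> (complex ^ 'n) set \<Rightarrow> enat" where
  "codimension X Z = Sup {enat n | n. \<exists>W. W 0 = Z \<and>
     (\<forall>k\<le>n. zariski_irreducible (W k) \<and> W k \<subseteq> X) \<and> (\<forall>k<n. W k \<subset> W (Suc k))}"

text \<open>
  A proper hypersurface of a closed algebraic set \<open>X\<close> is a proper closed subset all of whose
  irreducible components have codimension one in \<open>X\<close>. The empty set is allowed.
\<close>

definition proper_hypersurface_of :: "(complex ^ 'n::finite) set \<Rightarrow> (complex ^ 'n) set \<Rightarrow> bool" where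
  "proper_hypersurface_of X Z \<longleftrightarrow> zariski_closed Z \<and> Z \<subset> X \<and>
     (\<forall>V. irreducible_component Z V \<longrightarrow> codimension X V = 1)"

text \<open>
  A hypersurface of degree \<open>D\<close> in \<open>\<complex>\<^sup>n\<close> is the zero set of a nonconstant polynomial of total degree \<open>D\<close>.
  The equation need not be squarefree, so hypersurfaces with multiplicities are included (with
  the degree counting multiplicities). In particular, a set is a hypersurface of some degree at
  most \<open>D\<close> in this sense iff its reduced equation has degree at most \<open>D\<close>.
\<close>

definition hypersurface_of_degree :: "nat \<Rightarrow> (complex ^ 'n::finite) set \<Rightarrow> bool" where
  "hypersurface_of_degree D H \<longleftrightarrow> (\<exists>f. total_degree f = D \<and> D \<ge> 1 \<and> H = zero_locus {f})"


section \<open>Convergence of subsets\<close>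

definition complex_vec :: "real ^ 'n \<Rightarrow> complex ^ 'n" where
  "complex_vec x = (\<chi> i. complex_of_real (x $ i))"

text \<open>The intersection in \<open>\<complex>\<^sup>n\<close> of \<open>H\<close> with a set \<open>C\<close> of real points, as a subset of \<open>C\<close>.\<close>

definition real_trace :: "(complex ^ 'n) set \<Rightarrow> (real ^ 'n) set \<Rightarrow> (real ^ 'n) set" where
  "real_trace H C = {x \<in> C. complex_vec x \<in> H}"

definition eps_nbhd :: "'m::metric_space set \<Rightarrow> 'm set \<Rightarrow> real \<Rightarrow> 'm set" where
  "eps_nbhd C S \<epsilon> = {z \<in> C. \<exists>y\<in>S. dist z y < \<epsilon>}"

text \<open>Only the inclusion of \<open>S\<^sub>m\<close> in neighbourhoods of \<open>S\<close> is required, so limits are not unique.\<close>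

definition subsets_converge :: "'m::metric_space set \<Rightarrow> (nat \<Rightarrow> 'm set) \<Rightarrow> 'm set \<Rightarrow> bool" where
  "subsets_converge C T S \<longleftrightarrow> (\<forall>m. T m \<subseteq> C) \<and> S \<subseteq> C \<and>
     (\<forall>\<epsilon>>0. \<exists>N. \<forall>m\<ge>N. T m \<subseteq> eps_nbhd C S \<epsilon>)"

end

theory Submission
  imports Defs "HOL-Complex_Analysis.Great_Picard"
begin

text \<open>
  Scale equations of the hypersurfaces so that the coefficients have \<open>l\<^sup>1\<close>-norm \<open>1\<close>. There are finitely
  many monomials of degree at most \<open>D\<close>, so along a subsequence the coefficients converge, and the
  limit polynomial is nonzero because its norm is \<open>1\<close>. If traces on \<open>C\<close> stayed away from the zero
  set of the limit, a limit point in the compact set \<open>C\<close> of points on them would contradict the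
  convergence of the values of the polynomials. The limit polynomial may be a nonzero constant; then
  the traces are eventually empty and any hyperplane serves as limit.
\<close>

lemma finite_monomials_degree_le:
  "finite {m :: 'n::finite \<Rightarrow>\<^sub>0 nat. (\<Sum>i\<in>UNIV. Poly_Mapping.lookup m i) \<le> D}" (is "finite ?M")
proof (rule finite_imageD)
  have "Poly_Mapping.lookup m i \<le> D" if "m \<in> ?M" for m :: "'n \<Rightarrow>\<^sub>0 nat" and i
    using that member_le_sum[of i UNIV "Poly_Mapping.lookup m"] by simp
  then have "Poly_Mapping.lookup ` ?M \<subseteq> {g. \<forall>i. (i \<in> UNIV \<longrightarrow> g i \<in> {..D}) \<and> (i \<notin> UNIV \<longrightarrow> g i = 0)}"
    by auto
  then show "finite (Poly_Mapping.lookup ` ?M)"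
    by (rule finite_subset) (intro finite_set_of_finite_funs, auto)
  show "inj_on Poly_Mapping.lookup ?M"
    by (simp add: inj_on_def poly_mapping_eqI)
qed

lemma total_degree_le_iff:
  "total_degree f \<le> D \<longleftrightarrow>
     Poly_Mapping.keys f \<subseteq> {m. (\<Sum>i\<in>UNIV. Poly_Mapping.lookup m i) \<le> D}"
  unfolding total_degree_def by auto

lemma eval_mpoly_superset:
  assumes "finite M" "Poly_Mapping.keys f \<subseteq> M"
  shows "eval_mpoly f z =
    (\<Sum>m\<in>M. Poly_Mapping.lookup f m * (\<Prod>i\<in>UNIV. (z $ i) ^ Poly_Mapping.lookup m i))"
  unfolding eval_mpoly_def
  by (rule sum.mono_neutral_left) (use assms in \<open>auto simp: in_keys_iff\<close>)

text \<open>Induction on the variables: for fixed values of the others, the relation is a univariate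
  polynomial in the new variable that vanishes everywhere, so each of its coefficients is a relation
  in fewer variables. Abstract indices \<open>K\<close> with exponents \<open>e\<close>, injective
  only after restriction to \<open>S\<close>, keep the index type fixed while variables are
  removed.\<close>

lemma monomials_independent:
  fixes c :: "'k \<Rightarrow> complex" and e :: "'k \<Rightarrow> 'n \<Rightarrow> nat"
  assumes "finite S" "finite K" "inj_on (\<lambda>m. restrict (e m) S) K"
    and "\<And>z. (\<Sum>m\<in>K. c m * (\<Prod>i\<in>S. z i ^ e m i)) = 0" "m \<in> K"
  shows "c m = 0"
  using assms
proof (induction S arbitrary: K m rule: finite_induct)
  \<comment> \<open>Without variables all restricted exponents coincide, so injectivity leaves one
    index and the relation reads \<open>c m = 0\<close>.\<close>
  case empty
  then have "K = {m}" by (auto simp: inj_on_def)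
  with empty.prems(3) show ?case by simp
next
  case (insert x S)
  define L where "L k = {m \<in> K. e m x = k}" for k
  define N where "N = Max ((\<lambda>m. e m x) ` K)"
  have N: "e m x \<le> N" if "m \<in> K" for m
    unfolding N_def using that insert.prems by simp
  have "(\<Sum>m\<in>L (e m x). c m * (\<Prod>i\<in>S. z i ^ e m i)) = 0" for z
  proof -
    define q where "q k = (\<Sum>m\<in>L k. c m * (\<Prod>i\<in>S. z i ^ e m i))" for k
    \<comment> \<open>Only the coordinate \<open>x\<close> of \<open>z\<close> is changed to
      \<open>t\<close>. Grouping by the exponent of \<open>x\<close> then collects the fibres
      \<open>L k\<close> into the coefficients \<open>q k\<close>.\<close>
    have "(\<Sum>k\<le>N. q k * t ^ k) = 0" for t
    proof -
      have "0 = (\<Sum>m\<in>K. c m * (\<Prod>i\<in>insert x S. (z(x := t)) i ^ e m i))"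
        using insert.prems by simp
      also have "\<dots> = (\<Sum>m\<in>K. c m * (\<Prod>i\<in>S. z i ^ e m i) * t ^ e m x)"
      proof (intro sum.cong refl)
        fix m
        have "(\<Prod>i\<in>S. (z(x := t)) i ^ e m i) = (\<Prod>i\<in>S. z i ^ e m i)"
          using insert.hyps by (intro prod.cong) auto
        then show "c m * (\<Prod>i\<in>insert x S. (z(x := t)) i ^ e m i)
            = c m * (\<Prod>i\<in>S. z i ^ e m i) * t ^ e m x"
          using insert.hyps by simp
      qed
      also have "\<dots> = (\<Sum>k\<le>N. \<Sum>m\<in>L k. c m * (\<Prod>i\<in>S. z i ^ e m i) * t ^ e m x)"
        unfolding L_def by (rule sum.group[symmetric]) (use N insert.prems in auto)
      also have "\<dots> = (\<Sum>k\<le>N. q k * t ^ k)"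
        by (intro sum.cong refl) (simp add: q_def L_def sum_distrib_right)
      finally show ?thesis by simp
    qed
    then have "\<forall>k\<le>N. q k = 0"
      using polyfun_eq_0[of q N] by blast
    then show ?thesis using N insert.prems unfolding q_def by blast
  qed
  \<comment> \<open>All indices in one fibre have the same exponent at \<open>x\<close>, so the
    remaining exponents tell them apart.\<close>
  moreover have "inj_on (\<lambda>m. restrict (e m) S) (L (e m x))"
  proof (rule inj_onI)
    fix a b assume ab: "a \<in> L (e m x)" "b \<in> L (e m x)" "restrict (e a) S = restrict (e b) S"
    then have "e a i = e b i" if "i \<in> insert x S" for i
      using that unfolding L_def by (auto simp: restrict_def fun_eq_iff split: if_splits)
    then have "restrict (e a) (insert x S) = restrict (e b) (insert x S)"
      by (auto simp: restrict_def)
    from inj_onD[OF insert.prems(2) this] ab show "a = b"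
      unfolding L_def by simp
  qed
  ultimately show ?case
    by (intro insert.IH[of "L (e m x)" m]) (use insert.prems in \<open>simp_all add: L_def del: restrict_apply\<close>)
qed

text \<open>Makes the limit hypersurface proper; for a constant polynomial it excludes the value
  0.\<close>

lemma zero_locus_nonzero_ne_UNIV:
  fixes f :: "('n::finite, complex) mpoly"
  assumes "f \<noteq> 0"
  shows "zero_locus {f} \<noteq> UNIV"
proof
  assume *: "zero_locus {f} = UNIV"
  from assms obtain m where m: "m \<in> Poly_Mapping.keys f" by fastforce
  have "(\<Sum>m\<in>Poly_Mapping.keys f.
      Poly_Mapping.lookup f m * (\<Prod>i\<in>UNIV. z i ^ Poly_Mapping.lookup m i)) = 0" for z
    using * unfolding zero_locus_def eval_mpoly_def
    by (auto simp: set_eq_iff dest: spec[of _ "\<chi> i. z i"])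
  moreover have "inj_on (\<lambda>m. restrict (Poly_Mapping.lookup m) UNIV) (Poly_Mapping.keys f)"
    by (auto simp: inj_on_def restrict_UNIV intro: poly_mapping_eqI)
  ultimately have "Poly_Mapping.lookup f m = 0"
    using monomials_independent[OF finite finite_keys _ _ m,
        where e = Poly_Mapping.lookup and c = "Poly_Mapping.lookup f"] by blast
  with m show False by (simp add: in_keys_iff)
qed

lemma eval_mpoly_total_degree_0:
  assumes "total_degree f = 0"
  shows "eval_mpoly f z = Poly_Mapping.lookup f 0"
proof -
  have "Poly_Mapping.keys f \<subseteq> {m. (\<Sum>i\<in>UNIV. Poly_Mapping.lookup m i) \<le> 0}"
    using assms total_degree_le_iff[of f 0] by simp
  then have "Poly_Mapping.keys f \<subseteq> {0}"
    by (auto intro!: poly_mapping_eqI)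
  then show ?thesis
    by (subst eval_mpoly_superset[of "{0}"]) auto
qed

lemma exists_hyperplane:
  "\<exists>V :: (complex ^ 'n::finite) set. hypersurface_of_degree 1 V \<and> V \<noteq> UNIV"
proof -
  define i :: 'n where "i = undefined"
  define f :: "('n, complex) mpoly" where
    "f = Poly_Mapping.single (Poly_Mapping.single i 1) 1"
  have "total_degree f = 1"
    by (simp add: total_degree_def f_def lookup_single when_def)
  \<comment> \<open>The zero polynomial has \<open>total_degree\<close> 0 by convention.\<close>
  moreover from this have "f \<noteq> 0"
    by (auto simp: total_degree_def)
  ultimately show ?thesis
    using zero_locus_nonzero_ne_UNIV unfolding hypersurface_of_degree_def by blast
qed

text \<open>Dividing an equation by the \<open>l^1\<close>-norm of its coefficients keeps its zero
  set. Summing over all monomials of degree at most \<open>D\<close>, not just the support, lets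
  equations of different hypersurfaces be compared coefficientwise.\<close>

lemma hypersurface_normalized_equation:
  assumes "hypersurface_of_degree D H"
  obtains a where "H = {z. (\<Sum>m | (\<Sum>i\<in>UNIV. Poly_Mapping.lookup m i) \<le> D.
        a m * (\<Prod>i\<in>UNIV. (z $ i) ^ Poly_Mapping.lookup m i)) = 0}"
    and "(\<Sum>m | (\<Sum>i\<in>UNIV. Poly_Mapping.lookup m i) \<le> D. cmod (a m)) = 1"
proof -
  let ?M = "{m. (\<Sum>i\<in>UNIV. Poly_Mapping.lookup m i) \<le> D}"
  from assms obtain f where f: "total_degree f = D" "D \<ge> 1" "H = zero_locus {f}"
    unfolding hypersurface_of_degree_def by blast
  have keys: "Poly_Mapping.keys f \<subseteq> ?M" using f(1) total_degree_le_iff[of f D] by simp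
  \<comment> \<open>Here \<open>D \<ge> 1\<close> matters, since the zero polynomial has
    \<open>total_degree\<close> 0.\<close>
  have "f \<noteq> 0" using f by (auto simp: total_degree_def)
  then obtain m where m: "m \<in> Poly_Mapping.keys f" by fastforce
  define s where "s = (\<Sum>m\<in>?M. cmod (Poly_Mapping.lookup f m))"
  have "s > 0"
    unfolding s_def using m keys finite_monomials_degree_le[of D]
    by (intro sum_pos2[of _ m]) (auto simp: in_keys_iff)
  show thesis
  proof (rule that[of "\<lambda>m. Poly_Mapping.lookup f m / of_real s"])
    have "(\<Sum>m\<in>?M. Poly_Mapping.lookup f m / of_real s * (\<Prod>i\<in>UNIV. (z $ i) ^ Poly_Mapping.lookup m i))
        = eval_mpoly f z / of_real s" for z
      by (simp add: eval_mpoly_superset[OF finite_monomials_degree_le keys] sum_divide_distrib)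
    then show "H = {z. (\<Sum>m\<in>?M. Poly_Mapping.lookup f m / of_real s *
        (\<Prod>i\<in>UNIV. (z $ i) ^ Poly_Mapping.lookup m i)) = 0}"
      using \<open>s > 0\<close> f(3) by (auto simp: zero_locus_def)
    have "(\<Sum>m\<in>?M. cmod (Poly_Mapping.lookup f m / of_real s)) = (\<Sum>m\<in>?M. cmod (Poly_Mapping.lookup f m) / s)"
      using \<open>s > 0\<close> by (simp add: norm_divide)
    also have "\<dots> = s / s"
      by (simp only: s_def sum_divide_distrib)
    finally show "(\<Sum>m\<in>?M. cmod (Poly_Mapping.lookup f m / of_real s)) = 1"
      using \<open>s > 0\<close> by simp
  qed
qed

text \<open>Convergence is a one-sided inclusion, so a limit may be enlarged within
  \<open>C\<close>. This allows an empty limit to be replaced by the trace of a hyperplane.\<close>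

lemma subsets_converge_mono:
  assumes "subsets_converge C T S" "S \<subseteq> S'" "S' \<subseteq> C"
  shows "subsets_converge C T S'"
proof -
  have "eps_nbhd C S \<epsilon> \<subseteq> eps_nbhd C S' \<epsilon>" for \<epsilon>
    using assms(2) unfolding eps_nbhd_def by blast
  then show ?thesis
    using assms unfolding subsets_converge_def by (meson order_trans)
qed

text \<open>If convergence fails, infinitely many \<open>T m\<close> contain points outside a fixed
  neighbourhood of \<open>S\<close>; by compactness these points accumulate at some \<open>l\<close>
  in \<open>C\<close>, and \<open>lim\<close> forces \<open>l\<close> into \<open>S\<close>. The
  subsequence \<open>u\<close> in \<open>lim\<close> is needed because bad points exist only for
  infinitely many indices.\<close>

lemma subsets_convergeI_compact:
  assumes "compact C" "\<And>k. T k \<subseteq> C" "S \<subseteq> C"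
    and lim: "\<And>u x l. \<lbrakk>strict_mono (u :: nat \<Rightarrow> nat); \<And>k. x k \<in> T (u k); x \<longlonglongrightarrow> l; l \<in> C\<rbrakk> \<Longrightarrow> l \<in> S"
  shows "subsets_converge C T S"
  unfolding subsets_converge_def
proof (intro conjI allI impI, use assms in simp_all, rule ccontr)
  fix \<epsilon> :: real
  assume "\<epsilon> > 0" and "\<nexists>N. \<forall>m\<ge>N. T m \<subseteq> eps_nbhd C S \<epsilon>"
  then have "infinite {m. \<not> T m \<subseteq> eps_nbhd C S \<epsilon>}"
    unfolding infinite_nat_iff_unbounded_le by blast
  then obtain u :: "nat \<Rightarrow> nat" where u: "strict_mono u" "\<And>k. \<not> T (u k) \<subseteq> eps_nbhd C S \<epsilon>"
    using infinite_enumerate[of "{m. \<not> T m \<subseteq> eps_nbhd C S \<epsilon>}"] by blast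
  then have "\<forall>k. \<exists>x. x \<in> T (u k) \<and> x \<notin> eps_nbhd C S \<epsilon>" by blast
  then obtain x where x: "\<And>k. x k \<in> T (u k)" "\<And>k. x k \<notin> eps_nbhd C S \<epsilon>" by metis
  then have "\<forall>k. x k \<in> C" using assms(2) by blast
  then obtain l v where l: "l \<in> C" "strict_mono (v :: nat \<Rightarrow> nat)" "(x \<circ> v) \<longlonglongrightarrow> l"
    using \<open>compact C\<close> unfolding compact_eq_seq_compact_metric seq_compact_def by blast
  have "l \<in> S"
    using lim[of "u \<circ> v" "x \<circ> v" l] u l x by (simp add: strict_mono_o)
  moreover obtain k where "dist ((x \<circ> v) k) l < \<epsilon>"
    using l(3) \<open>\<epsilon> > 0\<close> unfolding lim_sequentially by blast
  ultimately have "x (v k) \<in> eps_nbhd C S \<epsilon>"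
    using \<open>\<forall>k. x k \<in> C\<close> unfolding eps_nbhd_def by auto
  with x(2) show False by blast
qed

text \<open>The degree can drop in the limit, even to 0, so the limit is given by a nonzero
  polynomial and not yet as a hypersurface.\<close>

lemma hypersurfaces_limit:
  fixes H :: "nat \<Rightarrow> (complex ^ 'n::finite) set"
  assumes "\<And>m. hypersurface_of_degree D (H m)" "compact C"
  obtains r f where "strict_mono (r :: nat \<Rightarrow> nat)" "f \<noteq> 0" "total_degree f \<le> D"
    "subsets_converge C (\<lambda>k. real_trace (H (r k)) C) (real_trace (zero_locus {f}) C)"
proof -
  define M where "M = {m :: 'n \<Rightarrow>\<^sub>0 nat. (\<Sum>i\<in>UNIV. Poly_Mapping.lookup m i) \<le> D}"
  have fin: "finite M" unfolding M_def by (rule finite_monomials_degree_le)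
  define is_eq where "is_eq k a \<longleftrightarrow>
      H k = {z. (\<Sum>m\<in>M. a m * (\<Prod>i\<in>UNIV. (z $ i) ^ Poly_Mapping.lookup m i)) = 0} \<and>
      (\<Sum>m\<in>M. cmod (a m)) = 1" for k a
  have "\<exists>a. is_eq k a" for k
    unfolding M_def is_eq_def by (rule hypersurface_normalized_equation[OF assms(1)[of k]]) blast
  then obtain a where "\<And>k. is_eq k (a k)" by metis
  then have H: "\<And>k. H k = {z. (\<Sum>m\<in>M. a k m * (\<Prod>i\<in>UNIV. (z $ i) ^ Poly_Mapping.lookup m i)) = 0}"
    and norm: "\<And>k. (\<Sum>m\<in>M. cmod (a k m)) = 1"
    unfolding is_eq_def by blast+
  \<comment> \<open>The normalization bounds every coefficient by 1, as the extraction of a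
    subsequence convergent at each monomial requires.\<close>
  have "cmod (a k m) \<le> 1" if "m \<in> M" for k m
    using member_le_sum[OF that, of "\<lambda>m. cmod (a k m)"] fin norm by simp
  then obtain r where r: "strict_mono (r :: nat \<Rightarrow> nat)" "\<And>m. m \<in> M \<Longrightarrow> \<exists>l. (\<lambda>n. a (r n) m) \<longlonglongrightarrow> l"
    using function_convergent_subsequence[OF countable_finite[OF fin], of a 1] by blast
  then obtain b where b: "\<And>m. m \<in> M \<Longrightarrow> (\<lambda>n. a (r n) m) \<longlonglongrightarrow> b m" by metis
  define f where "f = (\<Sum>m\<in>M. Poly_Mapping.single m (b m))"
  have coeff: "Poly_Mapping.lookup f m = (if m \<in> M then b m else 0)" for m
    unfolding f_def lookup_sum lookup_single when_def using fin by simp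
  then have keys: "Poly_Mapping.keys f \<subseteq> M" by (auto simp: in_keys_iff split: if_splits)
  \<comment> \<open>The norm is a finite sum, so it passes to the limit and some limit coefficient
    is nonzero.\<close>
  have "(\<lambda>n. \<Sum>m\<in>M. cmod (a (r n) m)) \<longlonglongrightarrow> (\<Sum>m\<in>M. cmod (b m))"
    by (intro tendsto_intros b)
  then have "(\<Sum>m\<in>M. cmod (b m)) = 1"
    using norm by (simp add: LIMSEQ_const_iff)
  then have "\<exists>m\<in>M. b m \<noteq> 0" by (metis norm_zero sum.neutral zero_neq_one)
  then have "f \<noteq> 0" using coeff by (metis lookup_zero)
  moreover have "total_degree f \<le> D" using keys unfolding M_def total_degree_le_iff .
  moreover have "subsets_converge C (\<lambda>k. real_trace (H (r k)) C) (real_trace (zero_locus {f}) C)"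
  proof (rule subsets_convergeI_compact)
    fix u :: "nat \<Rightarrow> nat" and x l
    assume u: "strict_mono u" and x: "\<And>k. x k \<in> real_trace (H (r (u k))) C"
      and l: "x \<longlonglongrightarrow> l" "l \<in> C"
    \<comment> \<open>\<open>?v\<close> is the value as a function of coefficients and real point
      together: both vary with \<open>n\<close>, and joint continuity carries the zeros to the
      limit.\<close>
    let ?v = "\<lambda>c z. \<Sum>m\<in>M. c m * (\<Prod>i\<in>UNIV. (complex_vec z $ i) ^ Poly_Mapping.lookup m i)"
    have "(\<lambda>n. a (r (u n)) m) \<longlonglongrightarrow> b m" if "m \<in> M" for m
      using LIMSEQ_subseq_LIMSEQ[OF b[OF that] u] by (simp add: o_def)
    moreover have "(\<lambda>n. complex_vec (x n) $ i) \<longlonglongrightarrow> complex_vec l $ i" for i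
      unfolding complex_vec_def vec_lambda_beta by (intro tendsto_intros l)
    ultimately have "(\<lambda>n. ?v (a (r (u n))) (x n)) \<longlonglongrightarrow> ?v b l"
      by (intro tendsto_sum tendsto_mult tendsto_prod tendsto_power)
    moreover have "?v (a (r (u n))) (x n) = 0" for n
      using x[of n] unfolding real_trace_def H by simp
    ultimately have "?v b l = 0" by (simp add: LIMSEQ_const_iff)
    moreover have "eval_mpoly f (complex_vec l) = ?v b l"
      by (simp add: eval_mpoly_superset[OF fin keys] coeff)
    ultimately show "l \<in> real_trace (zero_locus {f}) C"
      using l(2) by (simp add: real_trace_def zero_locus_def)
  qed (use assms(2) in \<open>auto simp: real_trace_def\<close>)
  ultimately show thesis using that r(1) by blast
qed

theorem theorem12p17:
  fixes I :: "('n::finite, real) mpoly set"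
    and C :: "(real ^ 'n) set"
    and H :: "nat \<Rightarrow> (complex ^ 'n) set"
    and D :: nat
  assumes "smooth_affine I"
    and "C = zero_locus I"
    and "compact C"
    and "\<And>m. hypersurface_of_degree D (H m)"
    and "\<And>m. proper_hypersurface_of (zero_locus (base_change I)) (H m \<inter> zero_locus (base_change I))"
  shows "\<exists>r H'. strict_mono (r :: nat \<Rightarrow> nat) \<and>
           (\<exists>D'\<le>D. hypersurface_of_degree D' H') \<and> H' \<noteq> UNIV \<and>
           subsets_converge C (\<lambda>k. real_trace (H (r k)) C) (real_trace H' C)"
proof -
  obtain r f where r: "strict_mono (r :: nat \<Rightarrow> nat)"
    and f: "f \<noteq> 0" "total_degree f \<le> D"
    and conv: "subsets_converge C (\<lambda>k. real_trace (H (r k)) C) (real_trace (zero_locus {f}) C)"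
    by (rule hypersurfaces_limit[OF assms(4) assms(3)])
  show ?thesis
  proof (cases "total_degree f = 0")
    case False
    then have "hypersurface_of_degree (total_degree f) (zero_locus {f})"
      unfolding hypersurface_of_degree_def by (intro exI[of _ f]) simp
    then show ?thesis using r f conv zero_locus_nonzero_ne_UNIV
      by (intro exI[of _ r] exI[of _ "zero_locus {f}"]) auto
  next
    case True
    \<comment> \<open>The value of \<open>f\<close> does not depend on the point, so not vanishing
      everywhere means vanishing nowhere.\<close>
    have "zero_locus {f} = {}"
      using zero_locus_nonzero_ne_UNIV[OF f(1)] eval_mpoly_total_degree_0[OF True]
      by (auto simp: zero_locus_def)
    moreover obtain V :: "(complex ^ 'n) set" where V: "hypersurface_of_degree 1 V" "V \<noteq> UNIV"
      using exists_hyperplane by blast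
    ultimately have "subsets_converge C (\<lambda>k. real_trace (H (r k)) C) (real_trace V C)"
      using conv by (elim subsets_converge_mono) (auto simp: real_trace_def)
    \<comment> \<open>Needed for the degree 1 of the substitute hyperplane to be within the
      bound.\<close>
    moreover have "1 \<le> D" using assms(4) unfolding hypersurface_of_degree_def by blast
    ultimately show ?thesis using r V by (intro exI[of _ r] exI[of _ V]) auto
  qed
qed

end
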